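(* In the graceful game, Bob has a winning strategy on the wheels $W_3$, $W_4$ and $W_5$ even when Alice is the first player.
   Context: The wheel $W_n$ ($n\geq 3$) is obtained from the cycle $(v_0,\dots,v_{n-1})$ by adding a central vertex $v_n$ adjacent to all $v_0,\dots,v_{n-1}$; it has $n+1$ vertices and $2n$ edges. A graceful labeling of a graph $G$ with $m$ edges is an injective map $f\colon V(G)\to\{0,1,\dots,m\}$ such that the induced edge labels $|f(u)-f(v)|$, $uv\in E(G)$, are pairwise distinct. The graceful game on a simple graph $G$ with $m$ edges: two players, Alice and Bob, alternately choose a free (not yet labeled) vertex and assign to it a label from $\{0,1,\dots,m\}$ not yet used. An edge both of whose endpoints are labeled gets label $|f(u)-f(v)|$; a move is legal only if after it all edge labels are pairwise distinct. Alice wins if the whole graph ends up gracefully labeled; Bob wins if he can prevent this. *)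

theory Defs
  imports Main
begin

record 'a ugraph =
  verts :: "'a set"
  edges :: "'a set set"

definition simple_graph :: "'a ugraph \<Rightarrow> bool" where
  "simple_graph G \<longleftrightarrow> finite (verts G) \<and> (\<forall>e\<in>edges G. e \<subseteq> verts G \<and> card e = 2)"

text \<open>The rim vertices of \<open>wheel n\<close> are \<open>0, \<dots>, n - 1\<close>, and \<open>n\<close> is the hub.\<close>

definition wheel :: "nat \<Rightarrow> nat ugraph" where
  "wheel n = \<lparr>verts = {0..n},
              edges = {{i, (i + 1) mod n} |i. i < n} \<union> {{i, n} |i. i < n}\<rparr>"

lemma simple_graph_wheel:
  assumes "n \<ge> 3"
  shows "simple_graph (wheel n)"
proof -
  have "e \<subseteq> {0..n} \<and> card e = 2" if e: "e \<in> edges (wheel n)" for e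
  proof -
    from e obtain i where i: "i < n" and "e = {i, (i + 1) mod n} \<or> e = {i, n}"
      unfolding wheel_def by auto
    moreover have "(i + 1) mod n \<noteq> i" "(i + 1) mod n \<le> n"
      using i assms by (cases "i + 1 = n"; simp)+
    ultimately obtain j where "e = {i, j}" "j \<le> n" "i \<noteq> j"
      by (metis le_refl nat_neq_iff)
    then show ?thesis using i by simp
  qed
  then show ?thesis
    by (simp add: simple_graph_def wheel_def)
qed

lemma card_verts_wheel: "card (verts (wheel n)) = n + 1"
  by (simp add: wheel_def)

lemma card_edges_wheel:
  assumes "n \<ge> 3"
  shows "card (edges (wheel n)) = 2 * n"
proof -
  let ?rim = "\<lambda>i. {i, (i + 1) mod n}" and ?spoke = "\<lambda>i. {i, n}"
  have eq: "edges (wheel n) = ?rim ` {..<n} \<union> ?spoke ` {..<n}"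
    unfolding wheel_def by auto
  have succ: "(i + 1) mod n = (if i + 1 = n then 0 else i + 1)" if "i < n" for i
    using that by simp
  have "inj_on ?rim {..<n}"
  proof (rule inj_onI)
    fix i j assume ij: "i \<in> {..<n}" "j \<in> {..<n}" "?rim i = ?rim j"
    then consider "i = j" | "i = (j + 1) mod n" "(i + 1) mod n = j"
      unfolding doubleton_eq_iff by blast
    then show "i = j"
    proof cases
      case 2
      have "j + 1 = n \<and> i = 0 \<or> i = j + 1" "i + 1 = n \<and> j = 0 \<or> j = i + 1"
        using 2 succ[of i] succ[of j] ij(1,2) by (metis lessThan_iff)+
      then show ?thesis
        using assms by linarith
    qed
  qed
  moreover have "inj_on ?spoke {..<n}"
    by (rule inj_onI) (auto simp: doubleton_eq_iff)
  moreover have "?rim ` {..<n} \<inter> ?spoke ` {..<n} = {}"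
  proof -
    have "?rim i \<noteq> ?spoke j" if "i < n" for i j
      using that assms mod_less_divisor[of n "i + 1"]
      unfolding doubleton_eq_iff by linarith
    then show ?thesis by blast
  qed
  ultimately show ?thesis
    unfolding eq by (subst card_Un_disjoint) (simp_all add: card_image del: One_nat_def)
qed

definition graceful_labeling :: "'a ugraph \<Rightarrow> ('a \<Rightarrow> nat) \<Rightarrow> bool" where
  "graceful_labeling G f \<longleftrightarrow>
     inj_on f (verts G) \<and>
     f ` verts G \<subseteq> {0..card (edges G)} \<and>
     (\<forall>u v x y. {u, v} \<in> edges G \<longrightarrow> {x, y} \<in> edges G \<longrightarrow>
        \<bar>int (f u) - int (f v)\<bar> = \<bar>int (f x) - int (f y)\<bar> \<longrightarrow> {u, v} = {x, y})"

definition distinct_edge_labels :: "'a ugraph \<Rightarrow> ('a \<rightharpoonup> nat) \<Rightarrow> bool" where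
  "distinct_edge_labels G p \<longleftrightarrow>
     (\<forall>u v x y a b c d. {u, v} \<in> edges G \<longrightarrow> {x, y} \<in> edges G \<longrightarrow>
        p u = Some a \<longrightarrow> p v = Some b \<longrightarrow> p x = Some c \<longrightarrow> p y = Some d \<longrightarrow>
        \<bar>int a - int b\<bar> = \<bar>int c - int d\<bar> \<longrightarrow> {u, v} = {x, y})"

type_synonym 'a move = "'a \<times> nat"

definition legal_move :: "'a ugraph \<Rightarrow> ('a \<rightharpoonup> nat) \<Rightarrow> 'a move \<Rightarrow> bool" where
  "legal_move G p = (\<lambda>(v, l).
     v \<in> verts G \<and> p v = None \<and> l \<in> {0..card (edges G)} \<and> l \<notin> ran p \<and>
     distinct_edge_labels G (p(v \<mapsto> l)))"

text \<open>
  A play is the chronological list of the moves made so far. No vertex is labeled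
  twice in a legal play, so \<open>map_of\<close> yields the current partial labeling.
\<close>

type_synonym 'a play = "'a move list"

definition legal_play :: "'a ugraph \<Rightarrow> 'a play \<Rightarrow> bool" where
  "legal_play G h \<longleftrightarrow> (\<forall>i<length h. legal_move G (map_of (take i h)) (h ! i))"

text \<open>
  A play ends when the player to move has no legal move; this includes the case
  that all vertices are labeled.
\<close>

definition finished_play :: "'a ugraph \<Rightarrow> 'a play \<Rightarrow> bool" where
  "finished_play G h \<longleftrightarrow> legal_play G h \<and> (\<nexists>mv. legal_move G (map_of h) mv)"

definition alice_wins_play :: "'a ugraph \<Rightarrow> 'a play \<Rightarrow> bool" where
  "alice_wins_play G h \<longleftrightarrow>
     finished_play G h \<and> dom (map_of h) = verts G \<and>
     graceful_labeling G (\<lambda>v. the (map_of h v))"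

definition bob_wins_play :: "'a ugraph \<Rightarrow> 'a play \<Rightarrow> bool" where
  "bob_wins_play G h \<longleftrightarrow> finished_play G h \<and> \<not> alice_wins_play G h"

datatype player = Alice | Bob

fun opponent :: "player \<Rightarrow> player" where
  "opponent Alice = Bob"
| "opponent Bob = Alice"

definition to_move :: "player \<Rightarrow> 'a play \<Rightarrow> player" where
  "to_move first h = (if even (length h) then first else opponent first)"

type_synonym 'a strategy = "'a play \<Rightarrow> 'a move"

definition bob_follows :: "player \<Rightarrow> 'a strategy \<Rightarrow> 'a play \<Rightarrow> bool" where
  "bob_follows first s h \<longleftrightarrow>
     (\<forall>i<length h. to_move first (take i h) = Bob \<longrightarrow> h ! i = s (take i h))"

text \<open>
  The first conjunct makes \<open>s\<close> answer with a legal move whenever Bob has one;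
  without it, a strategy could win vacuously by proposing illegal moves.
\<close>

definition bob_winning_strategy :: "'a ugraph \<Rightarrow> player \<Rightarrow> 'a strategy \<Rightarrow> bool" where
  "bob_winning_strategy G first s \<longleftrightarrow>
     (\<forall>h. legal_play G h \<and> bob_follows first s h \<and> to_move first h = Bob \<and>
          (\<exists>mv. legal_move G (map_of h) mv) \<longrightarrow> legal_move G (map_of h) (s h)) \<and>
     (\<forall>h. finished_play G h \<and> bob_follows first s h \<longrightarrow> bob_wins_play G h)"

definition bob_has_winning_strategy :: "'a ugraph \<Rightarrow> player \<Rightarrow> bool" where
  "bob_has_winning_strategy G first \<longleftrightarrow> (\<exists>s. bob_winning_strategy G first s)"

end

theory Submission
  imports Defs
begin

text \<open>
  Bob ruins the game with his very first move: he reaches a position that no graceful labeling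
  extends, and from then on it does not matter who plays what. The edge label \<open>2n\<close> of \<open>W\<^sub>n\<close> joins
  the labels \<open>0\<close> and \<open>2n\<close>, and when neither of them is on the hub, their spokes have the labels
  \<open>h\<close> and \<open>2n - h\<close>, where \<open>h\<close> is the hub label. Hence \<open>h = n\<close> is impossible, and so is a rim label
  \<open>2h\<close> or \<open>2h - 2n\<close>, whose spoke would repeat one of the two. If Alice plays \<open>0\<close> or \<open>2n\<close>
  on the hub or \<open>n\<close> on the rim, then Bob plays the other one of the pair: for \<open>n \<le> 5\<close>, no graceful
  labeling has \<open>0\<close> or \<open>2n\<close> on the hub and \<open>n\<close> on the rim.
\<close>

section \<open>Ruining moves\<close>

definition fatal :: "'a ugraph \<Rightarrow> ('a \<rightharpoonup> nat) \<Rightarrow> bool" where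
  "fatal G p \<longleftrightarrow> (\<nexists>f. graceful_labeling G f \<and> p \<subseteq>\<^sub>m Some \<circ> f)"

lemma fatal_mono: "fatal G p \<Longrightarrow> p \<subseteq>\<^sub>m q \<Longrightarrow> fatal G q"
  unfolding fatal_def by (blast intro: map_le_trans)

lemma not_alice_wins_play_if_fatal_take:
  assumes "fatal G (map_of (take k h))"
  shows "\<not> alice_wins_play G h"
proof
  assume "alice_wins_play G h"
  then have "graceful_labeling G (\<lambda>v. the (map_of h v))"
    by (simp add: alice_wins_play_def)
  moreover have "map_of h \<subseteq>\<^sub>m Some \<circ> (\<lambda>v. the (map_of h v))"
    by (auto simp: map_le_def)
  ultimately have "\<not> fatal G (map_of h)"
    by (auto simp: fatal_def)
  moreover have "map_of (take k h) \<subseteq>\<^sub>m map_of h"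
    by (metis append_take_drop_id map_le_map_add map_of_append)
  ultimately show False
    using assms fatal_mono by blast
qed

definition ruining_move :: "'a ugraph \<Rightarrow> 'a play \<Rightarrow> 'a move \<Rightarrow> bool" where
  "ruining_move G h mv \<longleftrightarrow> legal_move G (map_of h) mv \<and> fatal G (map_of (h @ [mv]))"

definition ruining_strategy :: "'a ugraph \<Rightarrow> 'a strategy" where
  "ruining_strategy G h =
     (if \<exists>mv. ruining_move G h mv then SOME mv. ruining_move G h mv
      else SOME mv. legal_move G (map_of h) mv)"

lemma ruining_move_ruining_strategy:
  assumes "\<exists>mv. ruining_move G h mv"
  shows "ruining_move G h (ruining_strategy G h)"
  using assms by (simp add: ruining_strategy_def someI_ex)

lemma legal_move_ruining_strategy:
  assumes "\<exists>mv. legal_move G (map_of h) mv"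
  shows "legal_move G (map_of h) (ruining_strategy G h)"
proof (cases "\<exists>mv. ruining_move G h mv")
  case True
  then show ?thesis
    using ruining_move_ruining_strategy unfolding ruining_move_def by blast
next
  case False
  then show ?thesis
    using someI_ex[OF assms] by (simp add: ruining_strategy_def)
qed

lemma not_finished_play_if_ruining_move: "ruining_move G h mv \<Longrightarrow> \<not> finished_play G h"
  unfolding ruining_move_def finished_play_def by blast

lemma bob_has_winning_strategy_if_ruining_move:
  assumes "\<And>h. finished_play G h \<Longrightarrow>
    \<exists>k<length h. to_move first (take k h) = Bob \<and> (\<exists>mv. ruining_move G (take k h) mv)"
  shows "bob_has_winning_strategy G first"
proof -
  have "bob_wins_play G h"
    if finished: "finished_play G h" and follows: "bob_follows first (ruining_strategy G) h" for h
  proof -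
    obtain k where turn: "k < length h" "to_move first (take k h) = Bob"
      and "\<exists>mv. ruining_move G (take k h) mv"
      using assms[OF finished] by blast
    then have "ruining_move G (take k h) (ruining_strategy G (take k h))"
      by (intro ruining_move_ruining_strategy)
    moreover have "h ! k = ruining_strategy G (take k h)"
      using follows turn by (simp add: bob_follows_def)
    ultimately have "fatal G (map_of (take (Suc k) h))"
      using turn(1) by (simp add: ruining_move_def take_Suc_conv_app_nth)
    then show ?thesis
      using finished not_alice_wins_play_if_fatal_take by (simp add: bob_wins_play_def)
  qed
  then have "bob_winning_strategy G first (ruining_strategy G)"
    using legal_move_ruining_strategy unfolding bob_winning_strategy_def by blast
  then show ?thesis
    by (auto simp: bob_has_winning_strategy_def)
qed

lemma bob_has_winning_strategy_if_ruining_first_moves: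
  assumes first_move: "\<exists>mv. ruining_move G [] mv"
    and second_move: "\<And>v l. legal_move G Map.empty (v, l) \<Longrightarrow> \<exists>mv. ruining_move G [(v, l)] mv"
  shows "bob_has_winning_strategy G first"
proof (rule bob_has_winning_strategy_if_ruining_move)
  fix h assume finished: "finished_play G h"
  then have "h \<noteq> []"
    using first_move not_finished_play_if_ruining_move by blast
  then obtain v l h' where h_eq: "h = (v, l) # h'"
    by (cases h) auto
  then have "legal_move G Map.empty (v, l)"
    using finished by (auto simp: finished_play_def legal_play_def)
  then obtain mv where ruining: "ruining_move G [(v, l)] mv"
    using second_move by blast
  then have "h' \<noteq> []"
    using finished not_finished_play_if_ruining_move unfolding h_eq by blast
  show "\<exists>k<length h. to_move first (take k h) = Bob \<and> (\<exists>mv. ruining_move G (take k h) mv)"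
  proof (cases first)
    case Bob
    then show ?thesis
      using first_move h_eq by (intro exI[of _ 0]) (auto simp: to_move_def)
  next
    case Alice
    then show ?thesis
      using ruining h_eq \<open>h' \<noteq> []\<close>
      by (intro exI[of _ 1] conjI exI[of _ mv]) (simp_all add: to_move_def)
  qed
qed

lemma distinct_edge_labels_if_two_labeled:
  assumes "simple_graph G" "dom p \<subseteq> {u, w}"
  shows "distinct_edge_labels G p"
proof -
  have "{x, y} = {u, w}" if "{x, y} \<in> edges G" "p x = Some a" "p y = Some b" for x y a b
  proof -
    have "x \<noteq> y" using that(1) assms(1) by (auto simp: simple_graph_def)
    moreover have "x \<in> {u, w}" "y \<in> {u, w}" using that(2,3) assms(2) by blast+
    ultimately show ?thesis by auto
  qed
  then show ?thesis
    unfolding distinct_edge_labels_def by metis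
qed

lemma legal_move_if_one_labeled:
  assumes "simple_graph G" "dom p \<subseteq> {u}" "w \<in> verts G" "p w = None"
    and "k \<le> card (edges G)" "k \<notin> ran p"
  shows "legal_move G p (w, k)"
  using assms distinct_edge_labels_if_two_labeled[of G "p(w \<mapsto> k)" u w]
  by (auto simp: legal_move_def)

lemma ruining_second_move:
  assumes "simple_graph G" "w \<in> verts G" "k \<le> card (edges G)" "v \<noteq> w" "l \<noteq> k"
    and "\<And>f. \<lbrakk>graceful_labeling G f; f v = l\<rbrakk> \<Longrightarrow> f w \<noteq> k"
  shows "ruining_move G [(v, l)] (w, k)"
proof -
  have "legal_move G (map_of [(v, l)]) (w, k)"
    using assms(1-5) by (intro legal_move_if_one_labeled[where u = v]) auto
  moreover have "fatal G (map_of [(v, l), (w, k)])"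
    using assms(4,6) by (auto simp: fatal_def map_le_def)
  ultimately show ?thesis
    by (simp add: ruining_move_def)
qed

section \<open>Graceful labelings\<close>

definition edge_label :: "('a \<Rightarrow> nat) \<Rightarrow> 'a set \<Rightarrow> nat" where
  "edge_label f e = Max (f ` e) - Min (f ` e)"

lemma int_edge_label: "int (edge_label f {u, v}) = \<bar>int (f u) - int (f v)\<bar>"
  by (simp add: edge_label_def max_def min_def)

lemma simple_graph_edgeE:
  assumes "simple_graph G" "e \<in> edges G"
  obtains u v where "e = {u, v}" "u \<noteq> v" "u \<in> verts G" "v \<in> verts G"
proof -
  have "e \<subseteq> verts G" "card e = 2"
    using assms by (auto simp: simple_graph_def)
  then show thesis
    using that by (auto simp: card_2_iff)
qed

lemma inj_on_edge_label:
  assumes "simple_graph G" "graceful_labeling G f"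
  shows "inj_on (edge_label f) (edges G)"
proof (rule inj_onI)
  fix e e' assume edges: "e \<in> edges G" "e' \<in> edges G" "edge_label f e = edge_label f e'"
  obtain u v where e_eq: "e = {u, v}"
    using simple_graph_edgeE[OF assms(1) edges(1)] .
  obtain x y where e'_eq: "e' = {x, y}"
    using simple_graph_edgeE[OF assms(1) edges(2)] .
  have "\<bar>int (f u) - int (f v)\<bar> = \<bar>int (f x) - int (f y)\<bar>"
    using edges(3) unfolding e_eq e'_eq int_edge_label[symmetric] by simp
  then show "e = e'"
    using edges(1,2) assms(2) unfolding e_eq e'_eq graceful_labeling_def by blast
qed

lemma image_edge_label_edges:
  assumes "simple_graph G" "graceful_labeling G f"
  shows "edge_label f ` edges G = {1..card (edges G)}"
proof (rule card_subset_eq)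
  show "edge_label f ` edges G \<subseteq> {1..card (edges G)}"
  proof (rule image_subsetI)
    fix e assume "e \<in> edges G"
    then obtain u v where edge: "e = {u, v}" "u \<noteq> v" "u \<in> verts G" "v \<in> verts G"
      by (rule simple_graph_edgeE[OF assms(1)])
    then have "f u \<noteq> f v" "f u \<le> card (edges G)" "f v \<le> card (edges G)"
      using assms(2) by (auto simp: graceful_labeling_def inj_on_eq_iff)
    then show "edge_label f e \<in> {1..card (edges G)}"
      using int_edge_label[of f u v] unfolding edge(1) atLeastAtMost_iff by linarith
  qed
  show "card (edge_label f ` edges G) = card {1..card (edges G)}"
    using inj_on_edge_label[OF assms] by (simp add: card_image)
qed simp

lemma graceful_labeling_extremal_edgeE:
  assumes "simple_graph G" "graceful_labeling G f" "card (edges G) > 0"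
  obtains u v where "{u, v} \<in> edges G" "f u = 0" "f v = card (edges G)"
proof -
  have "card (edges G) \<in> edge_label f ` edges G"
    using assms by (simp add: image_edge_label_edges)
  then obtain e where edge: "e \<in> edges G" "edge_label f e = card (edges G)"
    by auto
  obtain u v where ends: "e = {u, v}" "u \<in> verts G" "v \<in> verts G"
    using simple_graph_edgeE[OF assms(1) edge(1)] .
  then have "f u \<le> card (edges G)" "f v \<le> card (edges G)"
    using assms(2) by (auto simp: graceful_labeling_def)
  moreover have "\<bar>int (f u) - int (f v)\<bar> = int (card (edges G))"
    using int_edge_label[of f u v] edge(2) by (simp add: ends(1))
  ultimately consider "f u = 0" "f v = card (edges G)" | "f v = 0" "f u = card (edges G)"
    by linarith
  then show thesis
    using that[of u v] that[of v u] edge(1) ends(1) by cases (simp_all add: insert_commute)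
qed

lemma graceful_labeling_complement:
  assumes "simple_graph G" "graceful_labeling G f"
  shows "graceful_labeling G (\<lambda>v. card (edges G) - f v)"
proof -
  have f_le: "f v \<le> card (edges G)" if "v \<in> verts G" for v
    using assms(2) that by (auto simp: graceful_labeling_def)
  have "inj_on (\<lambda>v. card (edges G) - f v) (verts G)"
    using assms(2) f_le by (auto simp: graceful_labeling_def inj_on_def) (metis diff_diff_cancel)
  moreover have "\<bar>int (card (edges G) - f u) - int (card (edges G) - f v)\<bar>
      = \<bar>int (f u) - int (f v)\<bar>" if "{u, v} \<in> edges G" for u v
    using that assms(1) f_le[of u] f_le[of v] by (auto simp: simple_graph_def)
  ultimately show ?thesis
    using assms(2) by (auto simp: graceful_labeling_def)
qed

lemma graceful_labeling_comp_automorphism: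
  assumes "simple_graph G" "graceful_labeling G f"
    and "inj_on \<phi> (verts G)" "\<phi> ` verts G \<subseteq> verts G" "\<And>e. e \<in> edges G \<Longrightarrow> \<phi> ` e \<in> edges G"
  shows "graceful_labeling G (f \<circ> \<phi>)"
proof -
  have f_inj: "inj_on f (verts G)" and f_range: "f ` verts G \<subseteq> {0..card (edges G)}"
    using assms(2) by (simp_all add: graceful_labeling_def)
  have "inj_on (f \<circ> \<phi>) (verts G)"
    using comp_inj_on[OF assms(3) inj_on_subset[OF f_inj assms(4)]] .
  moreover have "(f \<circ> \<phi>) ` verts G \<subseteq> {0..card (edges G)}"
    using f_range assms(4) by force
  moreover have "{u, v} = {x, y}"
    if edges: "{u, v} \<in> edges G" "{x, y} \<in> edges G"
      and labels: "\<bar>int (f (\<phi> u)) - int (f (\<phi> v))\<bar> = \<bar>int (f (\<phi> x)) - int (f (\<phi> y))\<bar>"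
    for u v x y
  proof -
    have "{\<phi> u, \<phi> v} \<in> edges G" "{\<phi> x, \<phi> y} \<in> edges G"
      using edges[THEN assms(5)] by simp_all
    then have "{\<phi> u, \<phi> v} = {\<phi> x, \<phi> y}"
      using labels assms(2) unfolding graceful_labeling_def by blast
    then have "\<phi> ` {u, v} = \<phi> ` {x, y}"
      by simp
    moreover have "{u, v} \<subseteq> verts G" "{x, y} \<subseteq> verts G"
      using edges assms(1) unfolding simple_graph_def by blast+
    ultimately show ?thesis
      by (simp only: inj_on_image_eq_iff[OF assms(3)])
  qed
  ultimately show ?thesis
    by (simp add: graceful_labeling_def)
qed

section \<open>Graceful labelings of wheels\<close>

lemma verts_wheel: "verts (wheel n) = {0..n}"
  by (simp add: wheel_def)

lemma spoke_in_edges_wheel: "i < n \<Longrightarrow> {i, n} \<in> edges (wheel n)"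
  by (auto simp: wheel_def)

lemma rim_in_edges_wheel: "i < n \<Longrightarrow> {i, (i + 1) mod n} \<in> edges (wheel n)"
  by (auto simp: wheel_def)

lemma graceful_wheel_distinct_edge_labels:
  assumes "n \<ge> 3" "graceful_labeling (wheel n) f"
  shows "distinct (map (\<lambda>i. \<bar>int (f i) - int (f ((i + 1) mod n))\<bar>) [0..<n] @
    map (\<lambda>i. \<bar>int (f i) - int (f n)\<bar>) [0..<n])"
proof -
  let ?es = "map (\<lambda>i. {i, (i + 1) mod n}) [0..<n] @ map (\<lambda>i. {i, n}) [0..<n]"
  have set_es: "set ?es = edges (wheel n)"
    by (auto simp: wheel_def)
  then have "distinct ?es"
    using card_edges_wheel[OF assms(1)] by (intro card_distinct) simp
  then have "distinct (map (edge_label f) ?es)"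
    using inj_on_edge_label[OF simple_graph_wheel[OF assms(1)] assms(2)] set_es
    unfolding distinct_map by (simp only: simp_thms)
  then have "distinct (map int (map (edge_label f) ?es))"
    unfolding distinct_map[of int] by (simp only: inj_on_of_nat simp_thms)
  then show ?thesis
    by (simp only: map_append map_map comp_def int_edge_label)
qed

lemma inj_on_add_mod: "inj_on (\<lambda>k. (k + i) mod n) {..<n}" for i n :: nat
proof (rule inj_onI)
  fix k l assume less: "k \<in> {..<n}" "l \<in> {..<n}" and eq: "(k + i) mod n = (l + i) mod n"
  define j where "j = i mod n"
  have "j < n"
    using less(1) by (simp add: j_def)
  have shift: "(m + i) mod n = (if m + j < n then m + j else m + j - n)" if "m < n" for m
  proof -
    have "(m + i) mod n = (m + j) mod n"
      by (simp only: j_def mod_add_right_eq)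
    then show ?thesis
      using that \<open>j < n\<close> by (simp add: le_mod_geq)
  qed
  show "k = l"
    using eq less \<open>j < n\<close> shift[of k] shift[of l] by (simp split: if_splits)
qed

lemma graceful_wheel_rotate:
  assumes "n \<ge> 3" "graceful_labeling (wheel n) f"
  shows "graceful_labeling (wheel n) (f \<circ> (\<lambda>v. if v < n then (v + i) mod n else v))"
    (is "graceful_labeling _ (f \<circ> ?rot)")
proof (rule graceful_labeling_comp_automorphism[OF simple_graph_wheel[OF assms(1)] assms(2)])
  have mod_less: "k mod n < n" for k
    using assms(1) by simp
  have rot_less: "?rot v < n \<longleftrightarrow> v < n" for v
    using mod_less by simp
  show "?rot ` verts (wheel n) \<subseteq> verts (wheel n)"
    by (rule image_subsetI) (simp add: verts_wheel mod_less[THEN less_imp_le])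
  show "inj_on ?rot (verts (wheel n))"
  proof (rule inj_onI)
    fix v w assume rot_eq: "v \<in> verts (wheel n)" "w \<in> verts (wheel n)" "?rot v = ?rot w"
    consider "v < n" "w < n" | "v = n" "w = n"
      using rot_eq(1,2) rot_less[of v] rot_less[of w] unfolding rot_eq(3) verts_wheel by fastforce
    then show "v = w"
    proof cases
      case 1
      then have "(v + i) mod n = (w + i) mod n"
        using rot_eq(3) by presburger
      then show ?thesis
        using inj_onD[OF inj_on_add_mod] 1 by blast
    qed simp
  qed
  fix e assume "e \<in> edges (wheel n)"
  then obtain k where edge: "k < n" "e = {k, (k + 1) mod n} \<or> e = {k, n}"
    by (auto simp: wheel_def)
  define k' where "k' = (k + i) mod n"
  have "((k + 1) mod n + i) mod n = (k' + 1) mod n"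
    by (simp only: k'_def mod_add_left_eq add.assoc add.commute[of i])
  then have rot_rim: "?rot ` {k, (k + 1) mod n} = {k', (k' + 1) mod n}"
    using edge(1) mod_less by (simp only: k'_def image_insert image_empty if_True)
  have rot_spoke: "?rot ` {k, n} = {k', n}"
    using edge(1) by (simp add: k'_def insert_commute)
  have "{k', (k' + 1) mod n} \<in> edges (wheel n)" "{k', n} \<in> edges (wheel n)"
    using mod_less by (auto simp: wheel_def k'_def)
  with edge(2) show "?rot ` e \<in> edges (wheel n)"
    by (elim disjE) (simp_all only: rot_rim rot_spoke)
qed

lemma graceful_wheel_spokes:
  assumes "graceful_labeling (wheel n) f" "i < n" "j < n" "i \<noteq> j"
  shows "f i + f j \<noteq> 2 * f n"
proof
  assume "f i + f j = 2 * f n"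
  then have "\<bar>int (f i) - int (f n)\<bar> = \<bar>int (f j) - int (f n)\<bar>"
    by linarith
  then have "{i, n} = {j, n}"
    using assms(1) spoke_in_edges_wheel[OF assms(2)] spoke_in_edges_wheel[OF assms(3)]
    unfolding graceful_labeling_def by blast
  then show False
    using assms(4) by (auto simp: doubleton_eq_iff)
qed

lemma graceful_wheel_extremesE:
  assumes "n \<ge> 3" "graceful_labeling (wheel n) f"
  obtains u v where "u \<le> n" "v \<le> n" "f u = 0" "f v = 2 * n"
proof (rule graceful_labeling_extremal_edgeE[OF simple_graph_wheel[OF assms(1)] assms(2)])
  fix u v assume "{u, v} \<in> edges (wheel n)" "f u = 0" "f v = card (edges (wheel n))"
  moreover from this(1) have "{u, v} \<subseteq> verts (wheel n)"
    using simple_graph_wheel[OF assms(1)] by (auto simp: simple_graph_def)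
  ultimately show thesis
    using that[of u v] assms(1) by (simp add: card_edges_wheel verts_wheel)
qed (use assms(1) in \<open>simp add: card_edges_wheel\<close>)

lemma graceful_wheel_rim_neq_double_hub:
  assumes "n \<ge> 3" "graceful_labeling (wheel n) f" "i < n" "0 < f n" "f n < 2 * n"
  shows "2 * f n \<notin> {f i, f i + 2 * n}"
proof -
  obtain u v where extremes: "u \<le> n" "v \<le> n" "f u = 0" "f v = 2 * n"
    using graceful_wheel_extremesE[OF assms(1,2)] .
  then have "u < n" "v < n"
    using assms(4,5) by (metis le_neq_implies_less less_irrefl)+
  then have "f i \<noteq> 2 * f n" if "i \<noteq> u"
    using graceful_wheel_spokes[OF assms(2,3) _ that] extremes(3) by simp
  moreover have "f i + 2 * n \<noteq> 2 * f n" if "i \<noteq> v"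
    using graceful_wheel_spokes[OF assms(2,3) \<open>v < n\<close> that] extremes(4) by simp
  ultimately show ?thesis
    using extremes(3,4) assms(4,5) by fastforce
qed

lemma graceful_wheel_hub_neq:
  assumes "n \<ge> 3" "graceful_labeling (wheel n) f"
  shows "f n \<noteq> n"
proof
  assume hub: "f n = n"
  obtain v where max: "v \<le> n" "f v = 2 * n"
    using graceful_wheel_extremesE[OF assms] .
  then have "v < n"
    using hub assms(1) by (cases "v = n") auto
  then show False
    using graceful_wheel_rim_neq_double_hub[OF assms \<open>v < n\<close>] hub max(2) assms(1) by simp
qed

lemma graceful_wheel_zero_hub_adjacent:
  assumes "graceful_labeling (wheel n) f" "f n = 0" "{u, v} \<in> edges (wheel n)" "u < n" "v < n"
  shows "f v \<noteq> 2 * f u"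
proof
  assume "f v = 2 * f u"
  then have "\<bar>int (f u) - int (f v)\<bar> = \<bar>int (f u) - int (f n)\<bar>"
    using assms(2) by simp
  then have "{u, v} = {u, n}"
    using assms(1,3) spoke_in_edges_wheel[OF assms(4)]
    unfolding graceful_labeling_def by blast
  then show False
    using assms(4,5) by (auto simp: doubleton_eq_iff)
qed

lemma graceful_wheel_label_range:
  assumes "n \<ge> 3" "graceful_labeling (wheel n) f" "f n = 0" "f v = 2 * n"
    and "i \<le> n" "u \<le> n" "v \<le> n" "i \<notin> {n, u, v}"
  shows "f i \<in> {1..2 * n - 1} - {f u}"
proof -
  have "inj_on f {0..n}" "f ` {0..n} \<subseteq> {0..2 * n}"
    using assms(1,2) by (simp_all add: graceful_labeling_def verts_wheel card_edges_wheel)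
  then have "f i \<le> 2 * n" "f i \<noteq> f n" "f i \<noteq> f u" "f i \<noteq> f v"
    using assms(5-8) by (auto simp: inj_on_eq_iff image_subset_iff)
  then show ?thesis
    using assms(3,4) by auto
qed

lemma not_distinct_labels_mod_4:
  fixes x y :: int
  assumes "{x, y} \<subseteq> {1..7} - {4}"
  shows "\<not> distinct [x, \<bar>x - 4\<bar>, \<bar>x - 8\<bar>, y, \<bar>y - 4\<bar>, \<bar>y - 8\<bar>]"
proof -
  have one_in: "1 \<in> {w, \<bar>w - 4\<bar>, \<bar>w - 8\<bar>}"
    if "w \<in> {x, y}" "distinct [w, \<bar>w - 4\<bar>, \<bar>w - 8\<bar>]" for w
  proof -
    have "w \<in> {1..7} - {4}"
      using that(1) assms by blast
    then have "w \<in> {1, 2, 3, 5, 6, 7}"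
      by (simp, presburger)
    then show ?thesis
      using that(2) by auto
  qed
  show ?thesis
  proof
    assume dist: "distinct [x, \<bar>x - 4\<bar>, \<bar>x - 8\<bar>, y, \<bar>y - 4\<bar>, \<bar>y - 8\<bar>]"
    then have "1 \<in> {x, \<bar>x - 4\<bar>, \<bar>x - 8\<bar>}" "1 \<in> {y, \<bar>y - 4\<bar>, \<bar>y - 8\<bar>}"
      using one_in[of x] one_in[of y] unfolding distinct.simps list.set by blast+
    moreover have "{x, \<bar>x - 4\<bar>, \<bar>x - 8\<bar>} \<inter> {y, \<bar>y - 4\<bar>, \<bar>y - 8\<bar>} = {}"
      using dist unfolding distinct.simps list.set by blast
    ultimately show False
      by blast
  qed
qed

text \<open>
  Up to sign modulo \<open>5\<close>, the labels derived from \<open>x\<close>, \<open>y\<close>, \<open>z\<close> are \<open>x\<close>, \<open>y\<close>, \<open>z\<close>, and the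
  classes are \<open>{1, 4, 6, 9}\<close> and \<open>{2, 3, 7, 8}\<close>. Those of \<open>x\<close> occupy three members of one class,
  so \<open>y\<close> and \<open>z\<close> would partition the other one, but \<open>z + \<bar>z - 5\<bar> \<noteq> 10\<close>.
\<close>

lemma not_distinct_labels_mod_5:
  fixes x y z :: int
  assumes "{x, y, z} \<subseteq> {1..9} - {5}"
  shows "\<not> distinct [x, \<bar>x - 5\<bar>, \<bar>x - 10\<bar>, y, \<bar>y - 10\<bar>, z, \<bar>z - 5\<bar>]"
proof
  assume dist: "distinct [x, \<bar>x - 5\<bar>, \<bar>x - 10\<bar>, y, \<bar>y - 10\<bar>, z, \<bar>z - 5\<bar>]"
  have range: "x \<in> {1, 4, 6, 9} \<union> {2, 3, 7, 8}" "y \<in> {1, 4, 6, 9} \<union> {2, 3, 7, 8}"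
    "z \<in> {1, 4, 6, 9} \<union> {2, 3, 7, 8}"
    using assms by (simp_all, presburger+)
  have disjoint: "{x, \<bar>x - 5\<bar>, \<bar>x - 10\<bar>} \<inter> {y, \<bar>y - 10\<bar>, z, \<bar>z - 5\<bar>} = {}"
    using dist unfolding distinct.simps list.set by blast
  have "distinct [y, \<bar>y - 10\<bar>, z, \<bar>z - 5\<bar>]"
    using dist unfolding distinct.simps by blast
  then have no_partition: False if "{y, z} \<subseteq> {1, 4, 6, 9} \<or> {y, z} \<subseteq> {2, 3, 7, 8}"
    using that unfolding insert_subset by (elim conjE disjE insertE) simp_all
  from range(1) show False
  proof
    assume "x \<in> {1, 4, 6, 9}"
    then have "{1, 4} \<subseteq> {x, \<bar>x - 5\<bar>, \<bar>x - 10\<bar>}"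
      by auto
    then have "{1, 4} \<inter> {y, \<bar>y - 10\<bar>, z, \<bar>z - 5\<bar>} = {}"
      using disjoint by blast
    then have "{y, z} \<subseteq> {2, 3, 7, 8}"
      using range(2,3) by auto
    then show False
      using no_partition by blast
  next
    assume "x \<in> {2, 3, 7, 8}"
    then have "{2, 3} \<subseteq> {x, \<bar>x - 5\<bar>, \<bar>x - 10\<bar>}"
      by auto
    then have "{2, 3} \<inter> {y, \<bar>y - 10\<bar>, z, \<bar>z - 5\<bar>} = {}"
      using disjoint by blast
    then have "{y, z} \<subseteq> {1, 4, 6, 9}"
      using range(2,3) by auto
    then show False
      using no_partition by blast
  qed
qed

lemma graceful_wheel_4_opposite_neq:
  assumes "graceful_labeling (wheel 4) f" "f 4 = 0" "f 0 = 4"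
  shows "f 2 \<noteq> 8"
proof
  assume "f 2 = 8"
  let ?x = "int (f 1)" and ?y = "int (f 3)"
  have "[0..<4] = [0, 1, 2, 3::nat]"
    by (simp add: upt_conv_Cons numeral_eq_Suc)
  then have "distinct [\<bar>4 - ?x\<bar>, \<bar>?x - 8\<bar>, \<bar>8 - ?y\<bar>, \<bar>?y - 4\<bar>, 4, ?x, 8, ?y]"
    using graceful_wheel_distinct_edge_labels[OF _ assms(1)] assms(2,3) \<open>f 2 = 8\<close>
    by (simp flip: numeral_2_eq_2)
  then have "distinct [?x, \<bar>?x - 4\<bar>, \<bar>?x - 8\<bar>, ?y, \<bar>?y - 4\<bar>, \<bar>?y - 8\<bar>]"
    unfolding abs_minus_commute[of 4] abs_minus_commute[of 8] distinct.simps list.set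
      insert_iff empty_iff by metis
  moreover have "{?x, ?y} \<subseteq> {1..7} - {4}"
    using graceful_wheel_label_range[OF _ assms(1), of 2 _ 0] assms(2,3) \<open>f 2 = 8\<close> by simp
  ultimately show False
    using not_distinct_labels_mod_4 by blast
qed

lemma graceful_wheel_5_opposite_neq:
  assumes "graceful_labeling (wheel 5) f" "f 5 = 0" "f 0 = 5"
  shows "f 2 \<noteq> 10" "f 3 \<noteq> 10"
proof -
  have upt: "[0..<5] = [0, 1, 2, 3, 4::nat]"
    by (simp add: upt_conv_Cons numeral_eq_Suc)
  note labels = graceful_wheel_distinct_edge_labels[OF _ assms(1)] upt assms(2,3)
  note range = graceful_wheel_label_range[OF _ assms(1), where u = 0]
  show "f 2 \<noteq> 10"
  proof
    assume "f 2 = 10"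
    let ?x = "int (f 1)" and ?y = "int (f 3)" and ?z = "int (f 4)"
    have "distinct [\<bar>5 - ?x\<bar>, \<bar>?x - 10\<bar>, \<bar>10 - ?y\<bar>, \<bar>?y - ?z\<bar>, \<bar>?z - 5\<bar>, 5, ?x, 10, ?y, ?z]"
      using labels \<open>f 2 = 10\<close> by (simp flip: numeral_2_eq_2)
    then have "distinct [?x, \<bar>?x - 5\<bar>, \<bar>?x - 10\<bar>, ?y, \<bar>?y - 10\<bar>, ?z, \<bar>?z - 5\<bar>]"
      unfolding abs_minus_commute[of 5] abs_minus_commute[of 10] distinct.simps list.set
        insert_iff empty_iff by metis
    moreover have "{?x, ?y, ?z} \<subseteq> {1..9} - {5}"
      using range[of 2] assms(2,3) \<open>f 2 = 10\<close> by simp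
    ultimately show False
      using not_distinct_labels_mod_5 by blast
  qed
  show "f 3 \<noteq> 10"
  proof
    assume "f 3 = 10"
    let ?x = "int (f 4)" and ?y = "int (f 2)" and ?z = "int (f 1)"
    have "distinct [\<bar>5 - ?z\<bar>, \<bar>?z - ?y\<bar>, \<bar>?y - 10\<bar>, \<bar>10 - ?x\<bar>, \<bar>?x - 5\<bar>, 5, ?z, ?y, 10, ?x]"
      using labels \<open>f 3 = 10\<close> by (simp flip: numeral_2_eq_2)
    then have "distinct [?x, \<bar>?x - 5\<bar>, \<bar>?x - 10\<bar>, ?y, \<bar>?y - 10\<bar>, ?z, \<bar>?z - 5\<bar>]"
      unfolding abs_minus_commute[of 5] abs_minus_commute[of 10] distinct.simps list.set
        insert_iff empty_iff by metis
    moreover have "{?x, ?y, ?z} \<subseteq> {1..9} - {5}"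
      using range[of 3] assms(2,3) \<open>f 3 = 10\<close> by simp
    ultimately show False
      using not_distinct_labels_mod_5 by blast
  qed
qed

lemma graceful_wheel_zero_hub_rim_0_neq:
  assumes n: "n \<in> {3, 4, 5}" and graceful: "graceful_labeling (wheel n) f" and hub: "f n = 0"
  shows "f 0 \<noteq> n"
proof
  assume rim: "f 0 = n"
  have "n \<ge> 3"
    using n by auto
  obtain v where max: "v \<le> n" "f v = 2 * n"
    using graceful_wheel_extremesE[OF \<open>n \<ge> 3\<close> graceful] .
  then have "f v \<noteq> f n" "f v \<noteq> f 0"
    using hub rim \<open>n \<ge> 3\<close> by simp_all
  then have "v \<noteq> n" "v \<noteq> 0"
    by metis+
  have "{0, 1} \<in> edges (wheel n)" "{0, n - 1} \<in> edges (wheel n)"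
    using rim_in_edges_wheel[of 0 n] rim_in_edges_wheel[of "n - 1" n] \<open>n \<ge> 3\<close>
    by (simp_all add: insert_commute)
  then have "f 1 \<noteq> f v" "f (n - 1) \<noteq> f v"
    using graceful_wheel_zero_hub_adjacent[OF graceful hub, of 0] rim max(2) \<open>n \<ge> 3\<close> by simp_all
  then have "v \<noteq> 1" "v \<noteq> n - 1"
    by auto
  then have "2 \<le> v" "v \<le> n - 2"
    using max(1) \<open>v \<noteq> n\<close> \<open>v \<noteq> 0\<close> by linarith+
  then have "n = 4 \<and> v = 2 \<or> n = 5 \<and> (v = 2 \<or> v = 3)"
    using n by (elim insertE emptyE) linarith+
  then show False
    using graceful_wheel_4_opposite_neq graceful_wheel_5_opposite_neq graceful hub rim max(2)
    by auto
qed

lemma graceful_wheel_zero_hub_rim_neq: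
  assumes "n \<in> {3, 4, 5}" "graceful_labeling (wheel n) f" "f n = 0" "i < n"
  shows "f i \<noteq> n"
proof -
  have "n \<ge> 3"
    using assms(1) by auto
  then show ?thesis
    using graceful_wheel_zero_hub_rim_0_neq[OF assms(1) graceful_wheel_rotate[OF _ assms(2)], of i]
      assms(3,4) by simp
qed

lemma graceful_wheel_max_hub_rim_neq:
  assumes "n \<in> {3, 4, 5}" "graceful_labeling (wheel n) f" "f n = 2 * n" "i < n"
  shows "f i \<noteq> n"
proof -
  have "n \<ge> 3"
    using assms(1) by auto
  then show ?thesis
    using graceful_wheel_zero_hub_rim_neq[OF assms(1)
        graceful_labeling_complement[OF simple_graph_wheel assms(2)] _ assms(4)]
      assms(3) by (simp add: card_edges_wheel)
qed

section \<open>Bob's replies\<close>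

lemma ruining_wheel_first_move:
  assumes "n \<ge> 3"
  shows "ruining_move (wheel n) [] (n, n)"
proof -
  have "legal_move (wheel n) Map.empty (n, n)"
    using assms
    by (intro legal_move_if_one_labeled simple_graph_wheel)
      (auto simp: verts_wheel card_edges_wheel)
  moreover have "fatal (wheel n) [n \<mapsto> n]"
    using graceful_wheel_hub_neq[OF assms] by (fastforce simp: fatal_def map_le_def)
  ultimately show ?thesis
    by (simp add: ruining_move_def)
qed

lemma ruining_wheel_second_move:
  assumes "n \<ge> 3" "w \<le> n" "k \<le> 2 * n" "v \<noteq> w" "l \<noteq> k"
    and "\<And>f. \<lbrakk>graceful_labeling (wheel n) f; f v = l\<rbrakk> \<Longrightarrow> f w \<noteq> k"
  shows "ruining_move (wheel n) [(v, l)] (w, k)"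
  using assms
  by (intro ruining_second_move) (simp_all add: simple_graph_wheel verts_wheel card_edges_wheel)

lemma ex_ruining_move_if_rim_labeled:
  assumes "n \<in> {3, 4, 5}" "v < n"
  shows "\<exists>mv. ruining_move (wheel n) [(v, l)] mv"
proof -
  have "n \<ge> 3"
    using assms(1) by auto
  show ?thesis
  proof (cases "l = n")
    case True
    then have "ruining_move (wheel n) [(v, l)] (n, 0)"
      using graceful_wheel_zero_hub_rim_neq[OF assms(1)] assms(2) \<open>n \<ge> 3\<close>
      by (intro ruining_wheel_second_move) auto
    then show ?thesis ..
  next
    case False
    then have "ruining_move (wheel n) [(v, l)] (n, n)"
      using graceful_wheel_hub_neq[OF \<open>n \<ge> 3\<close>] assms(2) \<open>n \<ge> 3\<close>
      by (intro ruining_wheel_second_move) auto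
    then show ?thesis ..
  qed
qed

lemma ex_ruining_move_if_hub_labeled:
  assumes "n \<in> {3, 4, 5}" "l \<le> 2 * n"
  shows "\<exists>mv. ruining_move (wheel n) [(n, l)] mv"
proof -
  have "n \<ge> 3"
    using assms(1) by auto
  have double: "2 * l \<noteq> f 0" "2 * l \<noteq> f 0 + 2 * n"
    if "graceful_labeling (wheel n) f" "f n = l" "0 < l" "l < 2 * n" for f
    using graceful_wheel_rim_neq_double_hub[OF \<open>n \<ge> 3\<close> that(1), of 0] that \<open>n \<ge> 3\<close> by auto
  consider (extreme) "l = 0 \<or> l = 2 * n" | (low) "0 < l" "l \<le> n" | (high) "n < l" "l < 2 * n"
    using assms(2) by linarith
  then show ?thesis
  proof cases
    case extreme
    then have "ruining_move (wheel n) [(n, l)] (0, n)"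
      using graceful_wheel_zero_hub_rim_neq[OF assms(1), of _ 0]
        graceful_wheel_max_hub_rim_neq[OF assms(1), of _ 0] \<open>n \<ge> 3\<close>
      by (intro ruining_wheel_second_move) force+
    then show ?thesis ..
  next
    case low
    then have "ruining_move (wheel n) [(n, l)] (0, 2 * l)"
      using double(1) \<open>n \<ge> 3\<close> by (intro ruining_wheel_second_move) force+
    then show ?thesis ..
  next
    case high
    then have "ruining_move (wheel n) [(n, l)] (0, 2 * l - 2 * n)"
      using double(2) \<open>n \<ge> 3\<close> by (intro ruining_wheel_second_move) force+
    then show ?thesis ..
  qed
qed

theorem theorem7:
  fixes n :: nat and first :: player
  assumes "n \<in> {3, 4, 5}"
  shows "bob_has_winning_strategy (wheel n) first"
proof (rule bob_has_winning_strategy_if_ruining_first_moves)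
  have "n \<ge> 3"
    using assms by auto
  then show "\<exists>mv. ruining_move (wheel n) [] mv"
    using ruining_wheel_first_move by blast
  fix v l assume "legal_move (wheel n) Map.empty (v, l)"
  then have "v \<le> n" "l \<le> 2 * n"
    using \<open>n \<ge> 3\<close> by (simp_all add: legal_move_def verts_wheel card_edges_wheel)
  then show "\<exists>mv. ruining_move (wheel n) [(v, l)] mv"
    using ex_ruining_move_if_rim_labeled[OF assms, of v l]
      ex_ruining_move_if_hub_labeled[OF assms, of l]
    by (cases "v = n") simp_all
qed

end
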